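(* For $1\le j\le k_{\max}$ the following holds: $$\lambda_j\ge(1-2\alpha_h)(1-2\beta_h)(1-\Theta_{h,j}^2)\big(1-2\hat c(\tilde\alpha_h+\tilde\beta_h)\Theta_{h,j}\big)\tilde\lambda_j,\qquad \hat c:=\frac{8}{\sqrt3}\,c_F\,\lambda_{k_{\max}}^{1/2}.$$
   Context: Setting. $H\subset\hat H$ are infinite-dimensional real Hilbert spaces, $H$ compactly embedded in $\hat H$; $a:H\times H\to\mathbb R$ is a bounded symmetric elliptic bilinear form; $b(\cdot,\cdot)$ is the scalar product of $\hat H$. Let $0<\lambda_1\le\lambda_2\le\dots$ be the eigenvalues (with multiplicity, tending to infinity) and $u_1,u_2,\ldots\in H$ corresponding eigenvectors of $a(u,v)=\lambda b(u,v)$ for all $v\in H$, with $a(u_k,u_\ell)=\lambda_k\delta_{k\ell}$, $b(u_k,u_\ell)=\delta_{k\ell}$. Fix $k_{\max}\in\mathbb N$. $H^{\rm ex}$ is a further real vector space, $\mathcal E:H\to H^{\rm ex}$ is a linear injective extension operator, and $\mathcal E_h^{-\ell}:H^{\rm ex}\to H$ is a linear operator with $\mathcal E_h^{-\ell}\mathcal E={\rm id}_H$. Write $u^e:=\mathcal E u$ and $U_j^e:={\rm span}\{u_1^e,\dots,u_j^e\}$. $V_h\subset H^{\rm ex}$ is a finite-dimensional subspace, $n:=\dim V_h$. On $H^{\rm ex}\times H^{\rm ex}$ there are bilinear forms $a_h=\tilde a_h+k_a$, $b_h=\tilde b_h+k_b$ with $\tilde a_h,\tilde b_h,k_a,k_b$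 symmetric positive semidefinite, and $a_h,b_h$ are positive definite on $V_h$; $|||u|||_h:=a_h(u,u)^{1/2}$, $\|u\|_h:=b_h(u,u)^{1/2}$ denote the seminorms. Discrete eigenproblem: $\tilde u_1,\dots,\tilde u_n\in V_h$ is a basis of $V_h$ and $0<\tilde\lambda_1\le\dots\le\tilde\lambda_n$ are such that $a_h(\tilde u_k,\tilde u_\ell)=\tilde\lambda_k\delta_{k\ell}$, $b_h(\tilde u_k,\tilde u_\ell)=\delta_{k\ell}$. Consistency assumptions. (i) There are $\alpha_{h,1},\alpha_{h,2},\beta_{h,1},\beta_{h,2}<1$, tending to $0$ as $h\downarrow0$, such that for all $u,v\in U_{k_{\max}}^e$: $|\tilde a_h(u,v)-a(\mathcal E_h^{-\ell}u,\mathcal E_h^{-\ell}v)|\le\alpha_{h,1}|||u|||_h|||v|||_h$, $|k_a(u,v)|\le\alpha_{h,2}|||u|||_h|||v|||_h$, $|\tilde b_h(u,v)-b(\mathcal E_h^{-\ell}u,\mathcal E_h^{-\ell}v)|\le\beta_{h,1}\|u\|_h\|v\|_h$, $|k_b(u,v)|\le\beta_{h,2}\|u\|_h\|v\|_h$. Set $\alpha_h:=\alpha_{h,1}+\alpha_{h,2}$, $\beta_h:=\beta_{h,1}+\beta_{h,2}$. (ii) There are $\tilde\alpha_h,\tilde\beta_h<1$, tending to $0$ as $h\downarrow0$, such that for all $u\in U_{k_{\max}}^e$, $v\in V_h+U_{k_{\max}}^e$: $|a_h(u,v)-a(\mathcal E_h^{-\ell}u,\mathcal E_h^{-\ell}v)|\le\tilde\alpha_h|||u|||_h|||v|||_h$,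 $|b_h(u,v)-b(\mathcal E_h^{-\ell}u,\mathcal E_h^{-\ell}v)|\le\tilde\beta_h\|u\|_h\|v\|_h$. It is assumed throughout that $\alpha_h,\beta_h,\tilde\alpha_h,\tilde\beta_h<\tfrac12$. Friedrichs assumption: there is $c_F>0$, independent of $h$, with $\|v\|_h\le c_F|||v|||_h$ for all $v\in V_h+U_{k_{\max}}^e$. Approximability: $P_h:H^{\rm ex}\to V_h$ is the $a_h$-orthogonal projection, $a_h(P_hw,v_h)=a_h(w,v_h)$ for all $v_h\in V_h$; it is assumed that $\dim P_h(U_{k_{\max}}^e)=k_{\max}$. For $1\le j\le k_{\max}$, $\Theta_{h,j}:=\max_{0\ne w\in U_j^e}|||w-P_hw|||_h/|||w|||_h$, and it is assumed that $\Theta_{h,j}\le\tfrac12$ for $j=1,\dots,k_{\max}$. *)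

theory Defs
  imports "HOL-Analysis.Analysis"
begin

definition findim :: "'a::real_vector set \<Rightarrow> bool"
  where "findim V \<longleftrightarrow> (\<exists>B. finite B \<and> V \<subseteq> span B)"

text \<open>The inclusion of \<open>H\<close> into the larger Hilbert space is modelled by an injective linear map
  \<open>\<iota>\<close>, since the two spaces carry different inner products.\<close>

definition compact_embedding :: "('a::real_normed_vector \<Rightarrow> 'b::real_normed_vector) \<Rightarrow> bool"
  where "compact_embedding \<iota> \<longleftrightarrow>
    bounded_linear \<iota> \<and> inj \<iota> \<and> (\<forall>B. bounded B \<longrightarrow> compact (closure (\<iota> ` B)))"

definition symmetric_form :: "('a \<Rightarrow> 'a \<Rightarrow> real) \<Rightarrow> bool"
  where "symmetric_form f \<longleftrightarrow> (\<forall>u v. f u v = f v u)"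

definition elliptic_form :: "('a::real_normed_vector \<Rightarrow> 'a \<Rightarrow> real) \<Rightarrow> bool"
  where "elliptic_form f \<longleftrightarrow> (\<exists>c>0. \<forall>u. c * (norm u)\<^sup>2 \<le> f u u)"

definition psd_form :: "('a::real_vector \<Rightarrow> 'a \<Rightarrow> real) \<Rightarrow> bool"
  where "psd_form f \<longleftrightarrow> bilinear f \<and> symmetric_form f \<and> (\<forall>u. 0 \<le> f u u)"

definition pos_def_on :: "('a::real_vector \<Rightarrow> 'a \<Rightarrow> real) \<Rightarrow> 'a set \<Rightarrow> bool"
  where "pos_def_on f V \<longleftrightarrow> (\<forall>v\<in>V. v \<noteq> 0 \<longrightarrow> 0 < f v v)"

definition form_norm :: "('a \<Rightarrow> 'a \<Rightarrow> real) \<Rightarrow> 'a \<Rightarrow> real"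
  where "form_norm f u = sqrt (f u u)"

definition eigenspace ::
    "('a::real_vector \<Rightarrow> 'a \<Rightarrow> real) \<Rightarrow> ('a \<Rightarrow> 'a \<Rightarrow> real) \<Rightarrow> real \<Rightarrow> 'a set"
  where "eigenspace a b \<mu> = {u. \<forall>v. a u v = \<mu> * b u v}"

text \<open>Sequences of eigenvalues and eigenvectors are indexed from 1; the value at 0 is irrelevant.
  The \<open>findim\<close> condition is needed because \<open>dim\<close> of an infinite-dimensional space and
  \<open>card\<close> of an infinite set are both 0.\<close>

definition eigenvalues_with_multiplicity ::
    "('a::real_vector \<Rightarrow> 'a \<Rightarrow> real) \<Rightarrow> ('a \<Rightarrow> 'a \<Rightarrow> real) \<Rightarrow> (nat \<Rightarrow> real) \<Rightarrow> bool"
  where "eigenvalues_with_multiplicity a b lam \<longleftrightarrow>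
    {\<mu>. \<exists>u\<in>eigenspace a b \<mu>. u \<noteq> 0} = lam ` {1..} \<and>
    (\<forall>\<mu>. findim (eigenspace a b \<mu>) \<and> dim (eigenspace a b \<mu>) = card {k. 1 \<le> k \<and> lam k = \<mu>})"

definition ext_span :: "('a \<Rightarrow> 'x::real_vector) \<Rightarrow> (nat \<Rightarrow> 'a) \<Rightarrow> nat \<Rightarrow> 'x set"
  where "ext_span E u j = span ((\<lambda>i. E (u i)) ` {1..j})"

definition sum_space :: "'a::real_vector set \<Rightarrow> 'a set \<Rightarrow> 'a set"
  where "sum_space V W = {v + w | v w. v \<in> V \<and> w \<in> W}"

definition is_orth_proj ::
    "('a::real_vector \<Rightarrow> 'a \<Rightarrow> real) \<Rightarrow> 'a set \<Rightarrow> ('a \<Rightarrow> 'a) \<Rightarrow> bool"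
  where "is_orth_proj f V P \<longleftrightarrow> (\<forall>w. P w \<in> V \<and> (\<forall>v\<in>V. f (P w) v = f w v))"

text \<open>For an orthogonal projection \<open>P\<close> the quotients lie in \<open>[0,1]\<close>; on a nonzero
  finite-dimensional \<open>W\<close> on which \<open>f\<close> is positive definite the supremum is a maximum.\<close>

definition approx_const ::
    "('a::real_vector \<Rightarrow> 'a \<Rightarrow> real) \<Rightarrow> ('a \<Rightarrow> 'a) \<Rightarrow> 'a set \<Rightarrow> real"
  where "approx_const f P W = (SUP w\<in>W - {0}. form_norm f (w - P w) / form_norm f w)"

end

theory Submission
  imports Defs
begin

text \<open>Let \<open>W\<close> be the extension of the span of the first \<open>j\<close> eigenvectors. By the min-max principle
  some \<open>w \<noteq> 0\<close> in \<open>W\<close> has a projection \<open>P w\<close> whose discrete Rayleigh quotient is at least the \<open>j\<close>th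
  discrete eigenvalue. Choose \<open>y\<close> in \<open>W\<close> with \<open>b\<^sub>h(y, \<cdot>) = a\<^sub>h(w, \<cdot>)\<close> on \<open>W\<close> and bound \<open>b\<^sub>h(P w, P w)\<close> from
  below by Cauchy-Schwarz against \<open>y\<close>. Then \<open>b\<^sub>h(P w, y)\<close> differs from \<open>a\<^sub>h(P w, P w)\<close> only by
  \<open>b\<^sub>h(z, y) - a\<^sub>h(z, T y)\<close>, where \<open>z\<close> is the part of the projection error that is
  \<open>a\<^sub>h\<close>-orthogonal to \<open>W\<close> and \<open>T\<close> is the solution operator of the continuous problem on \<open>W\<close>; this
  is a pure consistency error, of size \<open>\<Theta>\<close> times the consistency constants. Finally \<open>a\<^sub>h\<close> is at most
  \<open>\<lambda>\<^sub>j (1 + \<beta>) / (1 - \<alpha>)\<close> times \<open>b\<^sub>h\<close> on \<open>W\<close>.\<close>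

section \<open>Positive semidefinite forms: Cauchy-Schwarz and Riesz representation\<close>

lemma psd_formD:
  assumes "psd_form f"
  shows "bilinear f" "f u v = f v u" "0 \<le> f u u"
  using assms by (auto simp: psd_form_def symmetric_form_def)

lemma psd_form_expand:
  fixes f :: "'x::real_vector \<Rightarrow> 'x \<Rightarrow> real"
  assumes "psd_form f"
  shows "f (u + v) w = f u w + f v w" "f u (v + w) = f u v + f u w"
    "f (u - v) w = f u w - f v w" "f u (v - w) = f u v - f u w"
    "f (c *\<^sub>R u) w = c * f u w" "f u (c *\<^sub>R w) = c * f u w"
  using psd_formD(1)[OF assms]
  by (simp_all add: bilinear_ladd bilinear_radd bilinear_lsub bilinear_rsub bilinear_lmul bilinear_rmul)

lemma psd_form_add:
  assumes "psd_form f" "psd_form g"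
  shows "psd_form (\<lambda>u v. f u v + g u v)"
  using assms unfolding psd_form_def symmetric_form_def bilinear_def
  by (auto intro: linear_compose_add)

lemma form_norm_nonneg: "psd_form f \<Longrightarrow> 0 \<le> form_norm f u"
  by (simp add: form_norm_def psd_formD)

lemma form_norm_sq: "psd_form f \<Longrightarrow> (form_norm f u)\<^sup>2 = f u u"
  by (simp add: form_norm_def psd_formD)

lemma form_norm_pos: "0 < f u u \<Longrightarrow> 0 < form_norm f u"
  by (simp add: form_norm_def)

lemma psd_form_cauchy_schwarz:
  assumes f: "psd_form f"
  shows "\<bar>f u v\<bar> \<le> form_norm f u * form_norm f v"
proof -
  note e = psd_form_expand[OF f]
  have q: "0 \<le> f u u + 2 * t * f u v + t\<^sup>2 * f v v" for t
  proof -
    have "f (u + t *\<^sub>R v) (u + t *\<^sub>R v) = f u u + 2 * t * f u v + t\<^sup>2 * f v v"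
      by (simp add: e psd_formD(2)[OF f, of v u] power2_eq_square algebra_simps)
    then show ?thesis using psd_formD(3)[OF f, of "u + t *\<^sub>R v"] by simp
  qed
  have "(f u v)\<^sup>2 \<le> f u u * f v v"
  proof (cases "f v v = 0")
    case True
    \<comment> \<open>Here \<open>q\<close> is affine in \<open>t\<close>, so nonnegativity forces
      its slope to vanish; otherwise the chosen \<open>t\<close> makes its value -1.\<close>
    have "f u v = 0"
    proof (rule ccontr)
      assume "f u v \<noteq> 0"
      then show False
        using q[of "- (f u u + 1) / (2 * f u v)"] True by (simp add: field_simps)
    qed
    then show ?thesis using True by simp
  next
    case False
    then have pos: "0 < f v v" using psd_formD(3)[OF f, of v] by linarith
    have "0 \<le> f u u - (f u v)\<^sup>2 / f v v"
      using q[of "- f u v / f v v"] pos by (simp add: field_simps power2_eq_square)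
    then show ?thesis using pos by (simp add: field_simps)
  qed
  then have "sqrt ((f u v)\<^sup>2) \<le> sqrt (f u u * f v v)" by (rule real_sqrt_le_mono)
  then show ?thesis by (simp add: form_norm_def real_sqrt_mult)
qed

text \<open>One Gram-Schmidt step per generator: the induction hypothesis for the functional
  \<open>f s\<close> gives the projection \<open>p\<close> of \<open>s\<close> onto
  \<open>span S\<close>, and the old representer is corrected along \<open>q = s - p\<close>, which
  is orthogonal to \<open>span S\<close>.\<close>

lemma psd_form_riesz:
  fixes f :: "'x::real_vector \<Rightarrow> 'x \<Rightarrow> real" and L :: "'x \<Rightarrow> real"
  assumes f: "psd_form f" and "finite S" "pos_def_on f (span S)" and L: "linear L"
  shows "\<exists>r\<in>span S. \<forall>z\<in>span S. f r z = L z"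
  using assms(2-4)
proof (induction S arbitrary: L rule: finite_induct)
  case empty
  then show ?case using psd_form_expand(5)[OF f, of 0] by (auto simp: linear_0)
next
  case (insert s S)
  note e = psd_form_expand[OF f]
  have sub: "span S \<subseteq> span (insert s S)" by (simp add: span_mono subset_insertI)
  have pd: "pos_def_on f (span S)"
    using insert.prems(1) sub by (auto simp: pos_def_on_def)
  obtain r where r: "r \<in> span S" "\<And>z. z \<in> span S \<Longrightarrow> f r z = L z"
    using insert.IH[OF pd insert.prems(2)] by auto
  have "linear (f s)" using psd_formD(1)[OF f] by (simp add: bilinear_def)
  then obtain p where p: "p \<in> span S" "\<And>z. z \<in> span S \<Longrightarrow> f p z = f s z"
    using insert.IH[OF pd] by blast
  define q where "q = s - p"
  have q_orth: "f q z = 0" "f z q = 0" if "z \<in> span S" for z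
    using p(2)[OF that] psd_formD(2)[OF f, of z q] by (simp_all add: q_def e)
  have q_in: "q \<in> span (insert s S)"
    unfolding q_def using p(1) sub by (auto intro: span_diff span_base)
  have q0: "L q = 0" if "f q q = 0"
    using insert.prems q_in that by (force simp: pos_def_on_def linear_0)
  show ?case
  proof (intro bexI ballI)
    fix z assume "z \<in> span (insert s S)"
    then obtain c where c: "z - c *\<^sub>R s \<in> span S" by (auto simp: span_insert)
    define y where "y = z - c *\<^sub>R q"
    have "y = (z - c *\<^sub>R s) + c *\<^sub>R p" by (simp add: y_def q_def algebra_simps)
    then have y: "y \<in> span S" using c p(1) by (simp add: span_add span_scale)
    have z: "z = y + c *\<^sub>R q" by (simp add: y_def)
    show "f (r + (L q / f q q) *\<^sub>R q) z = L z"
      using r(2)[OF y] q_orth[OF y] q_orth[OF r(1)] q0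
      by (cases "f q q = 0")
        (simp_all add: z e linear_add[OF insert.prems(2)] linear_scale[OF insert.prems(2)])
  next
    show "r + (L q / f q q) *\<^sub>R q \<in> span (insert s S)"
      using r(1) sub q_in by (auto intro: span_add span_scale)
  qed
qed

section \<open>Orthonormal systems, diagonal forms and dimension counting\<close>

lemma linear_scaleR_left:
  fixes f :: "'x::real_vector \<Rightarrow> real"
  assumes "linear f"
  shows "linear (\<lambda>z. f z *\<^sub>R c)"
  by (rule linearI) (simp_all add: linear_add[OF assms] linear_scale[OF assms] scaleR_left_distrib)

text \<open>The difference of both sides is linear in \<open>z\<close>, so its kernel is a subspace,
  and it contains every \<open>x k\<close>.\<close>

lemma orthonormal_expansion:
  fixes x :: "'i \<Rightarrow> 'x::real_vector" and f :: "'x \<Rightarrow> 'x \<Rightarrow> real"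
  assumes f: "bilinear f" and "finite I"
    and on: "\<And>i k. i \<in> I \<Longrightarrow> k \<in> I \<Longrightarrow> f (x i) (x k) = (if i = k then 1 else 0)"
    and z: "z \<in> span (x ` I)"
  shows "z = (\<Sum>i\<in>I. f z (x i) *\<^sub>R x i)"
  using z
proof (induction rule: span_induct)
  case base
  have "linear (\<lambda>z. f z v)" for v using f by (simp only: bilinear_def)
  then have lin: "linear (\<lambda>z. z - (\<Sum>i\<in>I. f z (x i) *\<^sub>R x i))"
    by (intro linear_compose_sub linear_compose_sum ballI linear_ident linear_scaleR_left)
  show ?case using linear_subspace_kernel[OF lin] by simp
next
  case (step y)
  then obtain k where k: "k \<in> I" "y = x k" by auto
  have "(\<Sum>i\<in>I. f y (x i) *\<^sub>R x i) = (\<Sum>i\<in>I. if i = k then x k else 0)"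
    using on k by (intro sum.cong) auto
  then show ?case using k \<open>finite I\<close> by simp
qed

lemma orthonormal_independent:
  fixes x :: "'i \<Rightarrow> 'x::real_vector" and f :: "'x \<Rightarrow> 'x \<Rightarrow> real"
  assumes f: "bilinear f" and "finite I"
    and on: "\<And>i k. i \<in> I \<Longrightarrow> k \<in> I \<Longrightarrow> f (x i) (x k) = (if i = k then 1 else 0)"
  shows "inj_on x I" "independent (x ` I)"
proof -
  show inj: "inj_on x I"
    using on by (intro inj_onI) (metis zero_neq_one)
  show "independent (x ` I)"
  proof (rule independent_if_scalars_zero)
    show "finite (x ` I)" using \<open>finite I\<close> by simp
  next
    fix g v assume g: "(\<Sum>y\<in>x ` I. g y *\<^sub>R y) = 0" and "v \<in> x ` I"
    then obtain k where k: "k \<in> I" "v = x k" by auto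
    have lin: "linear (\<lambda>y. f y (x k))" using f by (simp add: bilinear_def)
    have "0 = f (\<Sum>i\<in>I. g (x i) *\<^sub>R x i) (x k)"
      using g inj linear_0[OF lin] by (simp add: sum.reindex)
    also have "\<dots> = (\<Sum>i\<in>I. g (x i) * f (x i) (x k))"
      by (simp add: linear_sum[OF lin] linear_scale[OF lin])
    also have "\<dots> = (\<Sum>i\<in>I. if i = k then g (x k) else 0)"
      using on k(1) by (intro sum.cong) auto
    also have "\<dots> = g v" using k \<open>finite I\<close> by simp
    finally show "g v = 0" by simp
  qed
qed

text \<open>The cross terms vanish after expanding both arguments. With \<open>g = f\<close> and
  \<open>l = 1\<close> this is Parseval's identity; it serves the discrete eigenbasis as well as the
  extended eigenvectors.\<close>

lemma diagonal_forms_expansion: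
  fixes x :: "'i \<Rightarrow> 'x::real_vector" and f g :: "'x \<Rightarrow> 'x \<Rightarrow> real"
  assumes f: "bilinear f" and g: "bilinear g" and "finite I"
    and on: "\<And>i k. i \<in> I \<Longrightarrow> k \<in> I \<Longrightarrow> f (x i) (x k) = (if i = k then 1 else 0)"
    and diag: "\<And>i k. i \<in> I \<Longrightarrow> k \<in> I \<Longrightarrow> g (x i) (x k) = (if i = k then l i else 0)"
    and z: "z \<in> span (x ` I)"
  shows "g z z = (\<Sum>i\<in>I. l i * (f z (x i))\<^sup>2)"
proof -
  let ?c = "\<lambda>i. f z (x i)"
  have z': "z = (\<Sum>i\<in>I. ?c i *\<^sub>R x i)"
    using orthonormal_expansion[OF f \<open>finite I\<close> on z] .
  have "g z z = g (\<Sum>i\<in>I. ?c i *\<^sub>R x i) (\<Sum>k\<in>I. ?c k *\<^sub>R x k)"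
    using z' by simp
  also have "\<dots> = (\<Sum>i\<in>I. \<Sum>k\<in>I. ?c i * ?c k * g (x i) (x k))"
    by (simp add: bilinear_sum[OF g] sum.cartesian_product bilinear_lmul[OF g]
        bilinear_rmul[OF g] mult_ac)
  also have "\<dots> = (\<Sum>i\<in>I. \<Sum>k\<in>I. if k = i then l i * (?c i)\<^sup>2 else 0)"
    using diag by (intro sum.cong) (auto simp: power2_eq_square)
  also have "\<dots> = (\<Sum>i\<in>I. l i * (?c i)\<^sup>2)" using \<open>finite I\<close> by simp
  finally show ?thesis .
qed

text \<open>An injective \<open>g\<close> would carry \<open>S\<close> to an independent set of too
  many vectors inside \<open>span T\<close>. The strict inequality makes \<open>S\<close> finite,
  since infinite sets have \<open>card\<close> 0.\<close>

lemma linear_map_kernel_nontrivial: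
  fixes g :: "'x::real_vector \<Rightarrow> 'y::real_vector"
  assumes g: "linear g" and S: "independent S"
    and T: "finite T" "card T < card S" and im: "g ` span S \<subseteq> span T"
  shows "\<exists>w\<in>span S. w \<noteq> 0 \<and> g w = 0"
proof (rule ccontr)
  assume "\<not> ?thesis"
  then have inj: "inj_on g (span S)"
    by (metis (no_types, lifting) inj_onI eq_iff_diff_eq_0 g linear_diff span_diff)
  have "independent (g ` S)"
    using linear_independent_injective_image[OF g S inj] .
  then have "card (g ` S) \<le> card T"
    using independent_span_bound[OF T(1)] im span_superset by blast
  moreover have "card (g ` S) = card S"
    using inj by (intro card_image) (meson inj_on_subset span_superset)
  ultimately show False using T(2) by simp
qed

section \<open>Orthogonal projections and the approximation constant\<close>

text \<open>The defect of additivity or homogeneity lies in \<open>V\<close> and is orthogonal to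
  \<open>V\<close>, hence to itself, so definiteness makes it vanish.\<close>

lemma orth_proj_linear:
  assumes f: "psd_form f" and V: "subspace V" "pos_def_on f V" and P: "is_orth_proj f V P"
  shows "linear P"
proof -
  note e = psd_form_expand[OF f]
  have PV: "P w \<in> V" "v \<in> V \<Longrightarrow> f (P w) v = f w v" for w v
    using P by (auto simp: is_orth_proj_def)
  have zero: "v = 0" if "v \<in> V" "f v v = 0" for v
    using V(2) that by (force simp: pos_def_on_def)
  show ?thesis
  proof (rule linearI)
    fix v w
    have m: "P (v + w) - (P v + P w) \<in> V"
      using PV V(1) by (simp add: subspace_add subspace_diff)
    show "P (v + w) = P v + P w"
      using zero[OF m] PV(2)[OF m] by (simp add: e(1,3))
  next
    fix c v
    have m: "P (c *\<^sub>R v) - c *\<^sub>R P v \<in> V"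
      using PV V(1) by (simp add: subspace_scale subspace_diff)
    show "P (c *\<^sub>R v) = c *\<^sub>R P v"
      using zero[OF m] PV(2)[OF m] by (simp add: e(3,5))
  qed
qed

lemma orth_proj_pythagoras:
  assumes f: "psd_form f" and P: "is_orth_proj f V P"
  shows "f (w - P w) (w - P w) = f w w - f (P w) (P w)"
proof -
  have "f (P w) (P w) = f w (P w)" using P by (simp add: is_orth_proj_def)
  then show ?thesis
    using psd_formD(2)[OF f, of w "P w"] by (simp add: psd_form_expand[OF f])
qed

text \<open>A supremum of reals dominates its members only if they are bounded above; Pythagoras
  supplies the bound 1, also for quotients with denominator 0.\<close>

lemma approx_const_bound:
  assumes f: "psd_form f" and P: "is_orth_proj f V P" and w: "w \<in> W" "w \<noteq> 0" "0 < f w w"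
  shows "form_norm f (w - P w) \<le> approx_const f P W * form_norm f w"
proof -
  have le1: "form_norm f (v - P v) / form_norm f v \<le> 1" for v
    using orth_proj_pythagoras[OF f P, of v] psd_formD(3)[OF f, of "P v"] psd_formD(3)[OF f, of v]
    by (auto simp: form_norm_def divide_le_eq)
  have "form_norm f (w - P w) / form_norm f w \<le> approx_const f P W"
    unfolding approx_const_def using w le1
    by (intro cSUP_upper) (auto intro!: bdd_aboveI2)
  then show ?thesis
    using form_norm_pos[where f = f, OF w(3)] by (simp add: pos_divide_le_eq)
qed

section \<open>The min-max principle\<close>

text \<open>The trial vector of the min-max principle: its image is orthogonal to the first \<open>j - 1\<close>
  discrete eigenvectors.\<close>

lemma min_max_trial_vector:
  fixes x :: "nat \<Rightarrow> 'x::real_vector" and g :: "'y::real_vector \<Rightarrow> 'x"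
    and A B :: "'x \<Rightarrow> 'x \<Rightarrow> real"
  assumes A: "bilinear A" and B: "bilinear B" and g: "linear g"
    and S: "independent S" "card S = j" and j: "1 \<le> j" "j \<le> n"
    and im: "g ` span S \<subseteq> span (x ` {1..n})"
    and on: "\<And>k l. k \<in> {1..n} \<Longrightarrow> l \<in> {1..n} \<Longrightarrow> B (x k) (x l) = (if k = l then 1 else 0)"
    and diag: "\<And>k l. k \<in> {1..n} \<Longrightarrow> l \<in> {1..n} \<Longrightarrow> A (x k) (x l) = (if k = l then t k else 0)"
    and mono: "\<And>k. j \<le> k \<Longrightarrow> k \<le> n \<Longrightarrow> t j \<le> t k"
  shows "\<exists>w\<in>span S. w \<noteq> 0 \<and> t j * B (g w) (g w) \<le> A (g w) (g w)"
proof -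
  \<comment> \<open>\<open>G\<close> is \<open>g\<close> followed by the \<open>B\<close>-orthogonal
    projection onto the first \<open>j - 1\<close> discrete eigenvectors; its range is too small for
    it to be injective on a space of dimension \<open>j\<close>.\<close>
  define G where "G w = (\<Sum>i\<in>{1..<j}. B (g w) (x i) *\<^sub>R x i)" for w
  have "linear (\<lambda>w. B (g w) y)" for y
    using linear_compose[OF g, of "\<lambda>v. B v y"] B by (simp add: bilinear_def o_def)
  then have G: "linear G"
    unfolding G_def by (intro linear_compose_sum ballI linear_scaleR_left)
  have "G ` span S \<subseteq> span (x ` {1..<j})"
    unfolding G_def by (intro image_subsetI span_sum span_scale span_base imageI)
  moreover have "card (x ` {1..<j}) < card S"
    using card_image_le[of "{1..<j}" x] S(2) j(1) by simp
  ultimately obtain w where w: "w \<in> span S" "w \<noteq> 0" "G w = 0"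
    using linear_map_kernel_nontrivial[OF G S(1), of "x ` {1..<j}"] by auto
  have orth: "B (g w) (x k) = 0" if k: "k \<in> {1..<j}" for k
  proof -
    have lin: "linear (\<lambda>y. B y (x k))" using B by (simp add: bilinear_def)
    have "0 = B (G w) (x k)" using w(3) linear_0[OF lin] by simp
    also have "\<dots> = (\<Sum>i\<in>{1..<j}. B (g w) (x i) * B (x i) (x k))"
      by (simp add: G_def linear_sum[OF lin] linear_scale[OF lin])
    also have "\<dots> = (\<Sum>i\<in>{1..<j}. if i = k then B (g w) (x k) else 0)"
      using on k j by (intro sum.cong) auto
    also have "\<dots> = B (g w) (x k)" using k by simp
    finally show ?thesis by simp
  qed
  have gw: "g w \<in> span (x ` {1..n})" using im w(1) by auto
  have "t j * B (g w) (g w) = (\<Sum>i\<in>{1..n}. t j * (B (g w) (x i))\<^sup>2)"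
    using diagonal_forms_expansion[OF B B _ on, of "{1..n}" "\<lambda>_. 1" "g w"] on gw
    by (simp add: sum_distrib_left)
  also have "\<dots> \<le> (\<Sum>i\<in>{1..n}. t i * (B (g w) (x i))\<^sup>2)"
  proof (rule sum_mono)
    fix i assume i: "i \<in> {1..n}"
    \<comment> \<open>Terms with \<open>i < j\<close> are zero by orthogonality; for the others
      \<open>t j\<close> is at most \<open>t i\<close>.\<close>
    show "t j * (B (g w) (x i))\<^sup>2 \<le> t i * (B (g w) (x i))\<^sup>2"
      using orth[of i] mono[of i] i by (cases "i < j") (auto intro: mult_right_mono)
  qed
  also have "\<dots> = A (g w) (g w)"
    using diagonal_forms_expansion[OF B A _ on diag gw] by simp
  finally show ?thesis using w by blast
qed

section \<open>Rayleigh quotient of a projected vector\<close>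

text \<open>Expanding \<open>B (P w) (P w)\<close> around \<open>B w w\<close> would leave a term linear in \<open>\<theta>\<close> without the
  factor \<open>\<epsilon>\<close>; testing \<open>P w\<close> with the vector \<open>y\<close> representing \<open>A w\<close> through \<open>B\<close> avoids it.\<close>

lemma projected_rayleigh_bound:
  fixes A B :: "'x::real_vector \<Rightarrow> 'x \<Rightarrow> real"
  assumes A: "psd_form A" and B: "psd_form B"
    and S: "finite S" "pos_def_on A (span S)" "pos_def_on B (span S)"
    and V: "subspace V" and P: "is_orth_proj A V P"
    and w: "w \<in> span S" "w \<noteq> 0"
    and L: "0 < L" "\<And>z. z \<in> span S \<Longrightarrow> A z z \<le> L * B z z"
    and \<theta>: "0 \<le> \<theta>" "\<theta> \<le> 1/2" "form_norm A (w - P w) \<le> \<theta> * form_norm A w"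
    and \<epsilon>: "0 \<le> \<epsilon>"
    and defect: "\<And>y. y \<in> span S \<Longrightarrow> \<exists>r\<in>span S. \<forall>z\<in>sum_space V (span S).
        \<bar>B y z - A r z\<bar> \<le> \<epsilon> * form_norm B y * form_norm A z"
  shows "(1 - \<theta>\<^sup>2) * (1 - 8 / 3 * sqrt L * \<epsilon> * \<theta>) * A (P w) (P w) \<le> L * B (P w) (P w)"
proof -
  note eA = psd_form_expand[OF A] and eB = psd_form_expand[OF B]
  define p where "p = form_norm A (P w)"
  define q where "q = form_norm B (P w)"
  define m where "m = form_norm A w"
  have p2: "p\<^sup>2 = A (P w) (P w)" and q2: "q\<^sup>2 = B (P w) (P w)" and m2: "m\<^sup>2 = A w w"
    by (simp_all add: p_def q_def m_def form_norm_sq A B)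
  have nn: "0 \<le> p" "0 \<le> q" by (simp_all add: p_def q_def form_norm_nonneg A B)
  have Aw: "0 < A w w" using S(2) w by (simp add: pos_def_on_def)
  then have m: "0 < m" by (simp add: m_def form_norm_pos)
  define e where "e = w - P w"
  obtain y where y: "y \<in> span S" "\<And>z. z \<in> span S \<Longrightarrow> B y z = A w z"
    using psd_form_riesz[OF B S(1,3), of "A w"] psd_formD(1)[OF A] by (auto simp: bilinear_def)
  obtain s where s: "s \<in> span S" "\<And>z. z \<in> span S \<Longrightarrow> A s z = A e z"
    using psd_form_riesz[OF A S(1,2), of "A e"] psd_formD(1)[OF A] by (auto simp: bilinear_def)
  obtain r where r: "r \<in> span S" "\<And>z. z \<in> sum_space V (span S) \<Longrightarrow>
      \<bar>B y z - A r z\<bar> \<le> \<epsilon> * form_norm B y * form_norm A z"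
    using defect[OF y(1)] by blast
  define Y where "Y = form_norm B y"
  have Ynn: "0 \<le> Y" by (simp add: Y_def form_norm_nonneg B)
  have y0: "0 < Y"
  proof -
    have "B y w = A w w" using y(2)[OF w(1)] .
    then have "y \<noteq> 0" using Aw eB(5)[of 0 0 w] by auto
    then show ?thesis using S(3) y(1) by (simp add: Y_def form_norm_pos pos_def_on_def)
  qed
  \<comment> \<open>\<open>Y\<close> squared equals \<open>B y y = A w y\<close>, which is at most
    \<open>m * form_norm A y\<close>, hence at most \<open>m * sqrt L * Y\<close>; then one factor
    \<open>Y\<close> cancels.\<close>
  have Yle: "Y \<le> sqrt L * m"
  proof -
    have "form_norm A y \<le> sqrt L * Y"
      using L(2)[OF y(1)] by (simp add: Y_def form_norm_def flip: real_sqrt_mult)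
    then have "m * form_norm A y \<le> m * (sqrt L * Y)" using m by simp
    moreover have "Y\<^sup>2 \<le> m * form_norm A y"
      using y(2)[OF y(1)] psd_form_cauchy_schwarz[OF A, of w y]
      by (simp add: Y_def m_def form_norm_sq B)
    ultimately have "Y * Y \<le> (sqrt L * m) * Y" by (simp add: power2_eq_square mult_ac)
    then show ?thesis using y0 by simp
  qed
  define z where "z = e - s"
  have z_orth: "A z v = 0" if "v \<in> span S" for v using s(2)[OF that] by (simp add: z_def eA)
  have z_in: "z \<in> sum_space V (span S)"
  proof -
    have "z = - P w + (w - s)" by (simp add: z_def e_def)
    moreover have "- P w \<in> V" using P V by (simp add: is_orth_proj_def subspace_neg)
    moreover have "w - s \<in> span S" using w s by (simp add: span_diff)
    ultimately show ?thesis unfolding sum_space_def by blast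
  qed
  have z_le: "form_norm A z \<le> \<theta> * m"
  proof -
    have "A s z = 0" using z_orth[OF s(1)] psd_formD(2)[OF A, of s z] by simp
    then have "A e e = A z z + A s s"
      using z_orth[OF s(1)] by (simp add: z_def eA)
    then have "form_norm A z \<le> form_norm A e"
      using psd_formD(3)[OF A, of s] by (simp add: form_norm_def)
    then show ?thesis using \<theta>(3) by (simp add: e_def m_def)
  qed
  \<comment> \<open>In the splitting \<open>e = z + s\<close> the contributions of \<open>s\<close>
    cancel, because \<open>B y s = A w s\<close>, and \<open>A z w = 0\<close>.\<close>
  have "B e y - A e w = B y z"
    using y(2)[OF s(1)] z_orth[OF w(1)] psd_formD(2)[OF B, of e y] psd_formD(2)[OF A, of w s]
    by (simp add: z_def eA eB)
  \<comment> \<open>Since \<open>A r z = 0\<close>, the defect estimate bounds \<open>B y z\<close>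
    itself.\<close>
  also have "\<dots> \<le> \<epsilon> * Y * form_norm A z"
    using r(2)[OF z_in] z_orth[OF r(1)] psd_formD(2)[OF A, of r z] by (simp add: Y_def)
  also have "\<dots> \<le> \<epsilon> * Y * (\<theta> * m)"
    using z_le \<epsilon> Ynn by (intro mult_left_mono) auto
  finally have \<delta>: "B e y - A e w \<le> \<epsilon> * Y * (\<theta> * m)" .
  have "B (P w) y = A w w - B e y"
    using y(2)[OF w(1)] psd_formD(2)[OF B, of w y] by (simp add: e_def eB)
  moreover have "A e w = A w w - A (P w) (P w)"
    using P psd_formD(2)[OF A, of "P w" w] by (simp add: e_def eA is_orth_proj_def)
  ultimately have "p\<^sup>2 - \<epsilon> * Y * (\<theta> * m) \<le> q * Y"
    using \<delta> psd_form_cauchy_schwarz[OF B, of "P w" y] by (simp add: p2 q_def Y_def)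
  then have pY: "p\<^sup>2 \<le> Y * (q + \<epsilon> * \<theta> * m)" by (simp add: algebra_simps)
  also have "\<dots> \<le> sqrt L * m * (q + \<epsilon> * \<theta> * m)"
    using Yle nn \<epsilon> \<theta>(1) m by (intro mult_right_mono) auto
  finally have main: "p\<^sup>2 - sqrt L * \<epsilon> * \<theta> * m\<^sup>2 \<le> sqrt L * m * q"
    by (simp add: algebra_simps power2_eq_square)
  have pm: "(1 - \<theta>\<^sup>2) * m\<^sup>2 \<le> p\<^sup>2"
  proof -
    have "(form_norm A (w - P w))\<^sup>2 \<le> (\<theta> * m)\<^sup>2"
      using \<theta>(3) by (intro power_mono) (auto simp: m_def form_norm_nonneg A)
    then show ?thesis
      using orth_proj_pythagoras[OF A P, of w]
      by (simp add: form_norm_sq A p2 m2 power_mult_distrib algebra_simps)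
  qed
  have \<theta>2: "\<theta>\<^sup>2 \<le> 1/4" using power_mono[OF \<theta>(2,1), of 2] by (simp add: power2_eq_square)
  have "3/4 * m\<^sup>2 \<le> (1 - \<theta>\<^sup>2) * m\<^sup>2" using \<theta>2 by (intro mult_right_mono) auto
  \<comment> \<open>The factor 4/3 is 1 / (1 - 1/4), from \<open>\<theta> \<le> 1/2\<close>.\<close>
  then have pm34: "m\<^sup>2 \<le> 4/3 * p\<^sup>2" using pm by simp
  define k where "k = sqrt L * \<epsilon> * \<theta>"
  have k: "0 \<le> k" using L(1) \<epsilon> \<theta>(1) by (simp add: k_def)
  have Lq: "0 \<le> L * q\<^sup>2" using L(1) by simp
  have goal: "(1 - \<theta>\<^sup>2) * (1 - 8/3 * k) * p\<^sup>2 \<le> L * q\<^sup>2"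
  \<comment> \<open>If the inequality fails, the left side is not positive and nothing remains to
    prove; if it holds, \<open>1 - 4/3 * k\<close> is positive and \<open>h\<close> may be
    squared.\<close>
  proof (cases "8/3 * k \<le> 1")
    case False
    have "(1 - \<theta>\<^sup>2) * (1 - 8/3 * k) * p\<^sup>2 \<le> 0"
      using False \<theta>2 by (intro mult_nonpos_nonneg mult_nonneg_nonpos) auto
    then show ?thesis using Lq by linarith
  next
    case True
    have "k * m\<^sup>2 \<le> k * (4/3 * p\<^sup>2)" using pm34 k by (rule mult_left_mono)
    then have h: "(1 - 4/3 * k) * p\<^sup>2 \<le> sqrt L * m * q"
      using main by (simp add: k_def algebra_simps)
    have "((1 - 4/3 * k) * p\<^sup>2)\<^sup>2 \<le> (sqrt L * m * q)\<^sup>2"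
      using h True by (intro power_mono) auto
    then have h2: "(1 - 4/3 * k)\<^sup>2 * (p\<^sup>2 * p\<^sup>2) \<le> m\<^sup>2 * (L * q\<^sup>2)"
      using L(1) by (simp add: power_mult_distrib power2_eq_square mult_ac)
    \<comment> \<open>Dropping the square of \<open>4/3 * k\<close> is what doubles 4/3 to
      8/3.\<close>
    have "1 - 8/3 * k \<le> (1 - 4/3 * k)\<^sup>2" by (simp add: power2_eq_square algebra_simps)
    then have "(1 - 8/3 * k) * (p\<^sup>2 * p\<^sup>2) \<le> (1 - 4/3 * k)\<^sup>2 * (p\<^sup>2 * p\<^sup>2)"
      by (intro mult_right_mono) auto
    \<comment> \<open>One factor \<open>p\<^sup>2\<close> is traded for \<open>m\<^sup>2\<close> by
      \<open>pm\<close>, so that \<open>m\<^sup>2\<close> cancels against the right side of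
      \<open>h2\<close>.\<close>
    moreover have "((1 - \<theta>\<^sup>2) * m\<^sup>2) * ((1 - 8/3 * k) * p\<^sup>2) \<le> p\<^sup>2 * ((1 - 8/3 * k) * p\<^sup>2)"
      using pm True by (intro mult_right_mono) auto
    ultimately have "m\<^sup>2 * ((1 - \<theta>\<^sup>2) * (1 - 8/3 * k) * p\<^sup>2) \<le> m\<^sup>2 * (L * q\<^sup>2)"
      using h2 by (simp add: mult_ac)
    then show ?thesis using m by simp
  qed
  then show ?thesis by (simp add: k_def p2 q2 mult_ac)
qed

section \<open>Consistency errors and the source problem\<close>

text \<open>The consistency constants are assumed bounded only from above; their sign comes from
  testing with a vector of positive norm.\<close>

lemma consistency_constant_nonneg:
  assumes "\<bar>d\<bar> \<le> c * form_norm f v * form_norm f v" "0 < f v v"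
  shows "0 \<le> c"
  using assms form_norm_pos[of f v]
  by (metis abs_ge_zero mult.assoc mult_pos_pos order_trans zero_le_mult_iff not_less)

text \<open>The constant 2 absorbs the stability constant \<open>(1 + \<sigma>) / (1 - \<tau>)\<close> of the solution operator:
  \<open>\<tau> * (1 + \<sigma>) / (1 - \<tau>) + \<sigma> \<le> 2 * (\<tau> + \<sigma>)\<close> holds precisely because \<open>\<tau> \<le> 1/2\<close>.\<close>

lemma source_problem_defect:
  fixes A B a b :: "'x::real_vector \<Rightarrow> 'x \<Rightarrow> real" and x :: "'i \<Rightarrow> 'x"
  assumes A: "psd_form A" and B: "psd_form B" and a: "bilinear a" and b: "bilinear b"
    and "finite I"
    and on: "\<And>i k. i \<in> I \<Longrightarrow> k \<in> I \<Longrightarrow> b (x i) (x k) = (if i = k then 1 else 0)"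
    and eig: "\<And>i z. i \<in> I \<Longrightarrow> a (x i) z = l i * b (x i) z" and l: "\<And>i. i \<in> I \<Longrightarrow> 0 < l i"
    and \<tau>: "0 \<le> \<tau>" "\<tau> < 1/2" and \<sigma>: "0 \<le> \<sigma>" and cF: "0 < cF"
    and sub: "span (x ` I) \<subseteq> Z"
    and cA: "\<And>v z. v \<in> span (x ` I) \<Longrightarrow> z \<in> Z \<Longrightarrow>
        \<bar>A v z - a v z\<bar> \<le> \<tau> * form_norm A v * form_norm A z"
    and cB: "\<And>v z. v \<in> span (x ` I) \<Longrightarrow> z \<in> Z \<Longrightarrow>
        \<bar>B v z - b v z\<bar> \<le> \<sigma> * form_norm B v * form_norm B z"
    and F: "\<And>z. z \<in> Z \<Longrightarrow> form_norm B z \<le> cF * form_norm A z"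
    and y: "y \<in> span (x ` I)"
  shows "\<exists>r\<in>span (x ` I). \<forall>z\<in>Z.
    \<bar>B y z - A r z\<bar> \<le> 2 * cF * (\<tau> + \<sigma>) * form_norm B y * form_norm A z"
proof -
  \<comment> \<open>\<open>r\<close> is the solution operator applied to \<open>y\<close>: each
    coefficient is divided by its eigenvalue, so \<open>a r z = b y z\<close> for every
    \<open>z\<close>, not only on the span.\<close>
  define r where "r = (\<Sum>i\<in>I. (b y (x i) / l i) *\<^sub>R x i)"
  have r_in: "r \<in> span (x ` I)"
    unfolding r_def by (intro span_sum span_scale span_base imageI)
  have source: "a r z = b y z" for z
  proof -
    have la: "linear (\<lambda>v. a v z)" and lb: "linear (\<lambda>v. b v z)"
      using a b by (auto simp: bilinear_def)
    have "a r z = (\<Sum>i\<in>I. b y (x i) / l i * a (x i) z)"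
      by (simp add: r_def linear_sum[OF la] linear_scale[OF la])
    also have "\<dots> = (\<Sum>i\<in>I. b y (x i) * b (x i) z)"
      using eig l by (intro sum.cong) (auto simp: less_imp_neq[THEN not_sym])
    also have "\<dots> = b (\<Sum>i\<in>I. b y (x i) *\<^sub>R x i) z"
      by (simp add: linear_sum[OF lb] linear_scale[OF lb])
    also have "\<dots> = b y z"
      using orthonormal_expansion[OF b \<open>finite I\<close> on y] by simp
    finally show ?thesis .
  qed
  define R where "R = form_norm A r"
  define Y where "Y = form_norm B y"
  have nn: "0 \<le> R" "0 \<le> Y" "0 \<le> form_norm B r" "\<And>z. 0 \<le> form_norm A z"
    by (simp_all add: R_def Y_def form_norm_nonneg A B)
  have rZ: "r \<in> Z" using r_in sub by auto
  \<comment> \<open>Stability: the source equation is tested with \<open>r\<close> itself, and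
    Friedrichs' inequality turns \<open>form_norm B r\<close> into \<open>cF * R\<close>.\<close>
  have stab: "(1 - \<tau>) * R \<le> (1 + \<sigma>) * cF * Y"
  proof -
    have "R * R - \<tau> * R * R \<le> a r r"
      using cA[OF r_in rZ] form_norm_sq[OF A, of r] by (simp add: R_def power2_eq_square)
    also have "a r r \<le> B y r + \<sigma> * Y * form_norm B r"
      using cB[OF y rZ] by (simp add: source Y_def)
    also have "\<dots> \<le> (1 + \<sigma>) * Y * form_norm B r"
      using psd_form_cauchy_schwarz[OF B, of y r] by (simp add: Y_def algebra_simps)
    also have "\<dots> \<le> (1 + \<sigma>) * Y * (cF * R)"
      using F[OF rZ] \<sigma> nn by (intro mult_left_mono) (auto simp: R_def)
    finally have "((1 - \<tau>) * R) * R \<le> ((1 + \<sigma>) * cF * Y) * R" by (simp add: algebra_simps)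
    then show ?thesis
    proof (cases "R = 0")
      case True
      then show ?thesis using \<sigma> cF nn by simp
    next
      case False
      then show ?thesis using nn(1) \<open>_ * R \<le> _ * R\<close> by simp
    qed
  qed
  have key: "\<tau> * R + \<sigma> * cF * Y \<le> 2 * cF * (\<tau> + \<sigma>) * Y"
  proof -
    have "\<tau> * ((1 - \<tau>) * R) \<le> \<tau> * ((1 + \<sigma>) * cF * Y)"
      using stab \<tau>(1) by (rule mult_left_mono)
    \<comment> \<open>After multiplying the claim by \<open>1 - \<tau>\<close> and inserting the
      stability bound, this product is exactly the remaining gap.\<close>
    moreover have "0 \<le> (\<tau> + \<sigma>) * (1 - 2 * \<tau>) * (cF * Y)"
      using \<tau> \<sigma> cF nn by simp
    ultimately have "(1 - \<tau>) * (\<tau> * R + \<sigma> * cF * Y) \<le> (1 - \<tau>) * (2 * cF * (\<tau> + \<sigma>) * Y)"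
      by (simp add: algebra_simps)
    then show ?thesis using \<tau>(2) by simp
  qed
  have "\<bar>B y z - A r z\<bar> \<le> 2 * cF * (\<tau> + \<sigma>) * Y * form_norm A z" if z: "z \<in> Z" for z
  proof -
    \<comment> \<open>As \<open>a r z = b y z\<close>, the difference consists of the two
      consistency errors \<open>B y z - b y z\<close> and \<open>a r z - A r z\<close>.\<close>
    have "\<bar>B y z - A r z\<bar> \<le> \<sigma> * Y * form_norm B z + \<tau> * R * form_norm A z"
      using cA[OF r_in z] cB[OF y z] by (simp add: source R_def Y_def)
    also have "\<dots> \<le> \<sigma> * Y * (cF * form_norm A z) + \<tau> * R * form_norm A z"
      using F[OF z] \<sigma> nn by (intro add_right_mono mult_left_mono) auto
    also have "\<dots> = (\<tau> * R + \<sigma> * cF * Y) * form_norm A z" by (simp add: algebra_simps)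
    also have "\<dots> \<le> (2 * cF * (\<tau> + \<sigma>) * Y) * form_norm A z"
      using key nn(4) by (rule mult_right_mono)
    finally show ?thesis .
  qed
  then show ?thesis using r_in Y_def by auto
qed

section \<open>The lower bound for the eigenvalues\<close>

theorem theorem5p5:
  fixes \<iota> :: "'a::{real_inner,complete_space} \<Rightarrow> 'b::{real_inner,complete_space}"
    and a b :: "'a \<Rightarrow> 'a \<Rightarrow> real"
    and lam :: "nat \<Rightarrow> real" and u :: "nat \<Rightarrow> 'a" and kmax :: nat
    and E :: "'a \<Rightarrow> 'x::real_vector"
    and Hs :: "real set" \<comment> \<open>the mesh sizes\<close>
    and El :: "real \<Rightarrow> 'x \<Rightarrow> 'a"
    and V :: "real \<Rightarrow> 'x set"
    and ta ka tb kb ah bh :: "real \<Rightarrow> 'x \<Rightarrow> 'x \<Rightarrow> real"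
    and tu :: "real \<Rightarrow> nat \<Rightarrow> 'x" and tlam :: "real \<Rightarrow> nat \<Rightarrow> real"
    and \<alpha>1 \<alpha>2 \<beta>1 \<beta>2 \<alpha> \<beta> t\<alpha> t\<beta> :: "real \<Rightarrow> real"
    and cF chat :: real
    and P :: "real \<Rightarrow> 'x \<Rightarrow> 'x"
    and \<Theta> :: "real \<Rightarrow> nat \<Rightarrow> real"
  assumes infinite_dim: "\<not> findim (UNIV :: 'a set)" "\<not> findim (UNIV :: 'b set)"
    and embedding: "compact_embedding \<iota>"
    and a: "bounded_bilinear a" "symmetric_form a" "elliptic_form a"
    and b: "\<And>v w. b v w = inner (\<iota> v) (\<iota> w)"
    and lam: "eigenvalues_with_multiplicity a b lam" "0 < lam 1"
      "\<And>k l. 1 \<le> k \<Longrightarrow> k \<le> l \<Longrightarrow> lam k \<le> lam l"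
      "filterlim lam at_top sequentially"
    and u: "\<And>k. 1 \<le> k \<Longrightarrow> u k \<in> eigenspace a b (lam k)"
      "\<And>k l. 1 \<le> k \<Longrightarrow> 1 \<le> l \<Longrightarrow> a (u k) (u l) = (if k = l then lam k else 0)"
      "\<And>k l. 1 \<le> k \<Longrightarrow> 1 \<le> l \<Longrightarrow> b (u k) (u l) = (if k = l then 1 else 0)"
    and E: "linear E" "inj E"
    and mesh: "Hs \<subseteq> {0<..}" "0 islimpt Hs"
    and El: "\<And>h. h \<in> Hs \<Longrightarrow> linear (El h)"
      "\<And>h v. h \<in> Hs \<Longrightarrow> El h (E v) = v"
    and V: "\<And>h. h \<in> Hs \<Longrightarrow> subspace (V h)" "\<And>h. h \<in> Hs \<Longrightarrow> findim (V h)"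
    and forms: "\<And>h. h \<in> Hs \<Longrightarrow> psd_form (ta h)" "\<And>h. h \<in> Hs \<Longrightarrow> psd_form (ka h)"
      "\<And>h. h \<in> Hs \<Longrightarrow> psd_form (tb h)" "\<And>h. h \<in> Hs \<Longrightarrow> psd_form (kb h)"
    and ah: "\<And>h v w. h \<in> Hs \<Longrightarrow> ah h v w = ta h v w + ka h v w"
    and bh: "\<And>h v w. h \<in> Hs \<Longrightarrow> bh h v w = tb h v w + kb h v w"
    and pos_def: "\<And>h. h \<in> Hs \<Longrightarrow> pos_def_on (ah h) (V h)"
      "\<And>h. h \<in> Hs \<Longrightarrow> pos_def_on (bh h) (V h)"
    and tu_basis: "\<And>h. h \<in> Hs \<Longrightarrow> inj_on (tu h) {1..dim (V h)}"
      "\<And>h. h \<in> Hs \<Longrightarrow> independent (tu h ` {1..dim (V h)})"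
      "\<And>h. h \<in> Hs \<Longrightarrow> span (tu h ` {1..dim (V h)}) = V h"
    and tlam: "\<And>h k. h \<in> Hs \<Longrightarrow> k \<in> {1..dim (V h)} \<Longrightarrow> 0 < tlam h k"
      "\<And>h k l. h \<in> Hs \<Longrightarrow> 1 \<le> k \<Longrightarrow> k \<le> l \<Longrightarrow> l \<le> dim (V h) \<Longrightarrow> tlam h k \<le> tlam h l"
    and tu: "\<And>h k l. h \<in> Hs \<Longrightarrow> k \<in> {1..dim (V h)} \<Longrightarrow> l \<in> {1..dim (V h)} \<Longrightarrow>
        ah h (tu h k) (tu h l) = (if k = l then tlam h k else 0)"
      "\<And>h k l. h \<in> Hs \<Longrightarrow> k \<in> {1..dim (V h)} \<Longrightarrow> l \<in> {1..dim (V h)} \<Longrightarrow>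
        bh h (tu h k) (tu h l) = (if k = l then 1 else 0)"
    and less_one: "\<And>h. h \<in> Hs \<Longrightarrow>
        \<alpha>1 h < 1 \<and> \<alpha>2 h < 1 \<and> \<beta>1 h < 1 \<and> \<beta>2 h < 1 \<and> t\<alpha> h < 1 \<and> t\<beta> h < 1"
    and vanishing: "(\<alpha>1 \<longlongrightarrow> 0) (at 0 within Hs)" "(\<alpha>2 \<longlongrightarrow> 0) (at 0 within Hs)"
      "(\<beta>1 \<longlongrightarrow> 0) (at 0 within Hs)" "(\<beta>2 \<longlongrightarrow> 0) (at 0 within Hs)"
      "(t\<alpha> \<longlongrightarrow> 0) (at 0 within Hs)" "(t\<beta> \<longlongrightarrow> 0) (at 0 within Hs)"
    and consistency1:
      "\<And>h v w. h \<in> Hs \<Longrightarrow> v \<in> ext_span E u kmax \<Longrightarrow> w \<in> ext_span E u kmax \<Longrightarrow>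
        \<bar>ta h v w - a (El h v) (El h w)\<bar> \<le> \<alpha>1 h * form_norm (ah h) v * form_norm (ah h) w"
      "\<And>h v w. h \<in> Hs \<Longrightarrow> v \<in> ext_span E u kmax \<Longrightarrow> w \<in> ext_span E u kmax \<Longrightarrow>
        \<bar>ka h v w\<bar> \<le> \<alpha>2 h * form_norm (ah h) v * form_norm (ah h) w"
      "\<And>h v w. h \<in> Hs \<Longrightarrow> v \<in> ext_span E u kmax \<Longrightarrow> w \<in> ext_span E u kmax \<Longrightarrow>
        \<bar>tb h v w - b (El h v) (El h w)\<bar> \<le> \<beta>1 h * form_norm (bh h) v * form_norm (bh h) w"
      "\<And>h v w. h \<in> Hs \<Longrightarrow> v \<in> ext_span E u kmax \<Longrightarrow> w \<in> ext_span E u kmax \<Longrightarrow>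
        \<bar>kb h v w\<bar> \<le> \<beta>2 h * form_norm (bh h) v * form_norm (bh h) w"
    and consistency2:
      "\<And>h v w. h \<in> Hs \<Longrightarrow> v \<in> ext_span E u kmax \<Longrightarrow>
        w \<in> sum_space (V h) (ext_span E u kmax) \<Longrightarrow>
        \<bar>ah h v w - a (El h v) (El h w)\<bar> \<le> t\<alpha> h * form_norm (ah h) v * form_norm (ah h) w"
      "\<And>h v w. h \<in> Hs \<Longrightarrow> v \<in> ext_span E u kmax \<Longrightarrow>
        w \<in> sum_space (V h) (ext_span E u kmax) \<Longrightarrow>
        \<bar>bh h v w - b (El h v) (El h w)\<bar> \<le> t\<beta> h * form_norm (bh h) v * form_norm (bh h) w"
    and \<alpha>: "\<And>h. \<alpha> h = \<alpha>1 h + \<alpha>2 h"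
    and \<beta>: "\<And>h. \<beta> h = \<beta>1 h + \<beta>2 h"
    and less_half: "\<And>h. h \<in> Hs \<Longrightarrow> \<alpha> h < 1/2 \<and> \<beta> h < 1/2 \<and> t\<alpha> h < 1/2 \<and> t\<beta> h < 1/2"
    and friedrichs: "0 < cF"
      "\<And>h v. h \<in> Hs \<Longrightarrow> v \<in> sum_space (V h) (ext_span E u kmax) \<Longrightarrow>
        form_norm (bh h) v \<le> cF * form_norm (ah h) v"
    and P: "\<And>h. h \<in> Hs \<Longrightarrow> is_orth_proj (ah h) (V h) (P h)"
      "\<And>h. h \<in> Hs \<Longrightarrow> dim (P h ` ext_span E u kmax) = kmax"
    and \<Theta>: "\<And>h j. \<Theta> h j = approx_const (ah h) (P h) (ext_span E u j)"
      "\<And>h j. h \<in> Hs \<Longrightarrow> j \<in> {1..kmax} \<Longrightarrow> \<Theta> h j \<le> 1/2"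
    and chat: "chat = 8 / sqrt 3 * cF * sqrt (lam kmax)"
  shows "\<forall>h\<in>Hs. \<forall>j\<in>{1..kmax}.
    lam j \<ge> (1 - 2 * \<alpha> h) * (1 - 2 * \<beta> h) * (1 - (\<Theta> h j)\<^sup>2)
      * (1 - 2 * chat * (t\<alpha> h + t\<beta> h) * \<Theta> h j) * tlam h j"
proof (intro ballI)
  fix h j assume h: "h \<in> Hs" and j: "j \<in> {1..kmax}"
  define A where "A = ah h"
  define B where "B = bh h"
  define n where "n = dim (V h)"
  define x where "x i = E (u i)" for i
  \<comment> \<open>Pulling \<open>a\<close> and \<open>b\<close> back along \<open>El h\<close>
    puts all forms on one space; since \<open>El h\<close> inverts \<open>E\<close>, the
    \<open>x i\<close> inherit orthonormality and the eigenvalue equation.\<close>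
  define a' where "a' v w = a (El h v) (El h w)" for v w
  define b' where "b' v w = b (El h v) (El h w)" for v w
  define U where "U = span (x ` {1..j})"
  define Z where "Z = sum_space (V h) (ext_span E u kmax)"
  have Uk: "ext_span E u j = U" by (simp add: ext_span_def x_def U_def)
  have U_sub: "U \<subseteq> ext_span E u kmax"
    unfolding ext_span_def U_def x_def using j by (intro span_mono image_mono) auto
  have Z_I: "v + w \<in> Z" if "v \<in> V h" "w \<in> ext_span E u kmax" for v w
    using that unfolding Z_def sum_space_def by blast
  have U_Z: "U \<subseteq> Z"
    using Z_I[OF subspace_0[OF V(1)[OF h]]] U_sub by auto
  have sum_Z: "sum_space (V h) U \<subseteq> Z"
    using Z_I U_sub unfolding sum_space_def by blast
  have A: "psd_form A"
    using psd_form_add[OF forms(1,2)[OF h]] by (simp add: A_def ah[OF h, abs_def])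
  have B: "psd_form B"
    using psd_form_add[OF forms(3,4)[OF h]] by (simp add: B_def bh[OF h, abs_def])
  have biA: "bilinear A" and biB: "bilinear B" using A B psd_formD(1) by auto
  have bi: "bilinear a'" "bilinear b'"
  proof -
    have El': "linear (El h)" using El(1)[OF h] .
    have \<iota>: "linear \<iota>"
      using embedding by (simp add: compact_embedding_def bounded_linear.linear)
    note s = linear_add[OF El'] linear_scale[OF El'] linear_add[OF \<iota>] linear_scale[OF \<iota>]
    show "bilinear a'"
      unfolding bilinear_def a'_def
      by (auto intro!: linearI simp: s bounded_bilinear.add_left[OF a(1)]
          bounded_bilinear.add_right[OF a(1)] bounded_bilinear.scaleR_left[OF a(1)]
          bounded_bilinear.scaleR_right[OF a(1)])
    show "bilinear b'"
      unfolding bilinear_def b'_def b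
      by (auto intro!: linearI simp: s inner_add_left inner_add_right)
  qed
  have on: "b' (x i) (x k) = (if i = k then 1 else 0)" if "i \<in> {1..j}" "k \<in> {1..j}" for i k
    using u(3)[of i k] El(2)[OF h] that by (simp add: b'_def x_def)
  have eig: "a' (x i) z = lam i * b' (x i) z" if "i \<in> {1..j}" for i z
    using u(1)[of i] El(2)[OF h] that by (simp add: a'_def b'_def x_def eigenspace_def)
  have diag: "a' (x i) (x k) = (if i = k then lam i else 0)" if "i \<in> {1..j}" "k \<in> {1..j}" for i k
    using eig[of i "x k"] on[of i k] that by simp
  have lam_pos: "0 < lam i" if "i \<in> {1..kmax}" for i
    using lam(2) lam(3)[of 1 i] that by auto
  have lam_j: "0 < lam j" "lam j \<le> lam kmax" using lam_pos[OF j] lam(3)[of j kmax] j by auto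
  have b'_sum: "b' w w = (\<Sum>i\<in>{1..j}. (b' w (x i))\<^sup>2)"
    and a'_sum: "a' w w = (\<Sum>i\<in>{1..j}. lam i * (b' w (x i))\<^sup>2)" if "w \<in> U" for w
    using diagonal_forms_expansion[OF bi(2) bi(2) _ on, of "{1..j}" "\<lambda>_. 1" w] on
      diagonal_forms_expansion[OF bi(2) bi(1) _ on diag, of "{1..j}" w] that
    by (simp_all add: U_def)
  have rayleigh: "a' w w \<le> lam j * b' w w" if "w \<in> U" for w
    unfolding a'_sum[OF that] b'_sum[OF that] sum_distrib_left
    using lam(3) by (intro sum_mono mult_right_mono) auto
  have a'_pos: "0 < a' w w" if w: "w \<in> U" "w \<noteq> 0" for w
  proof (rule ccontr)
    assume neg: "\<not> ?thesis"
    have nn: "\<forall>i\<in>{1..j}. 0 \<le> lam i * (b' w (x i))\<^sup>2"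
      using lam_pos j by (simp add: less_imp_le)
    then have "(\<Sum>i\<in>{1..j}. lam i * (b' w (x i))\<^sup>2) = 0"
      using neg sum_nonneg[of "{1..j}" "\<lambda>i. lam i * (b' w (x i))\<^sup>2"] by (simp add: a'_sum[OF w(1)])
    then have "\<forall>i\<in>{1..j}. lam i * (b' w (x i))\<^sup>2 = 0"
      using nn by (subst (asm) sum_nonneg_eq_0_iff) auto
    then have z: "b' w (x i) = 0" if "i \<in> {1..j}" for i
      using lam_pos[of i] that j by force
    have "w = (\<Sum>i\<in>{1..j}. b' w (x i) *\<^sub>R x i)"
      using orthonormal_expansion[OF bi(2) _ on, of "{1..j}" w] w(1) by (simp add: U_def)
    also have "\<dots> = 0" using z by (intro sum.neutral) auto
    finally show False using w(2) by simp
  qed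
  have consA: "\<bar>A w w - a' w w\<bar> \<le> \<alpha> h * A w w" if w: "w \<in> U" for w
  proof -
    have "\<bar>A w w - a' w w\<bar> \<le> \<bar>ta h w w - a (El h w) (El h w)\<bar> + \<bar>ka h w w\<bar>"
      by (simp add: A_def a'_def ah[OF h])
    also have "\<dots> \<le> \<alpha> h * (form_norm A w)\<^sup>2"
      using consistency1(1,2)[OF h, of w w] w U_sub
      by (auto simp: A_def \<alpha> power2_eq_square algebra_simps)
    finally show ?thesis by (simp add: form_norm_sq[OF A])
  qed
  have consB: "\<bar>B w w - b' w w\<bar> \<le> \<beta> h * B w w" if w: "w \<in> U" for w
  proof -
    have "\<bar>B w w - b' w w\<bar> \<le> \<bar>tb h w w - b (El h w) (El h w)\<bar> + \<bar>kb h w w\<bar>"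
      by (simp add: B_def b'_def bh[OF h])
    also have "\<dots> \<le> \<beta> h * (form_norm B w)\<^sup>2"
      using consistency1(3,4)[OF h, of w w] w U_sub
      by (auto simp: B_def \<beta> power2_eq_square algebra_simps)
    finally show ?thesis by (simp add: form_norm_sq[OF B])
  qed
  \<comment> \<open>Definiteness is assumed on \<open>V h\<close> only. On \<open>U\<close> it
    follows from consistency: \<open>A w w = 0\<close> would force
    \<open>a' w w = 0\<close>.\<close>
  have A_pos: "0 < A w w" if w: "w \<in> U" "w \<noteq> 0" for w
    using a'_pos[OF w] consA[OF w(1)] psd_formD(3)[OF A, of w] by (cases "A w w = 0") auto
  have b'_pos: "0 < b' w w" if w: "w \<in> U" "w \<noteq> 0" for w
    using a'_pos[OF w] rayleigh[OF w(1)] lam_j(1) by (metis less_le_trans zero_less_mult_pos)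
  have B_pos: "0 < B w w" if w: "w \<in> U" "w \<noteq> 0" for w
    using b'_pos[OF w] consB[OF w(1)] psd_formD(3)[OF B, of w] by (cases "B w w = 0") auto

  \<comment> \<open>The trial vector and the signs of the constants\<close>
  have lin_P: "linear (P h)"
    using orth_proj_linear[OF A V(1)[OF h]] pos_def(1)[OF h] P(1)[OF h] by (simp add: A_def)
  have proj: "is_orth_proj A (V h) (P h)" using P(1)[OF h] by (simp add: A_def)
  have PV: "P h w \<in> V h" for w using proj by (simp add: is_orth_proj_def)
  \<comment> \<open>That the projected space keeps dimension \<open>kmax\<close> ensures that a
    \<open>j\<close>th discrete eigenvalue exists.\<close>
  have "dim (P h ` ext_span E u kmax) \<le> card (tu h ` {1..n})"
    using PV tu_basis(3)[OF h] by (intro dim_le_card) (auto simp: n_def)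
  also have "\<dots> \<le> n" using card_image_le[of "{1..n}" "tu h"] by simp
  finally have jn: "j \<le> n" using P(2)[OF h] j by simp
  have ind: "inj_on x {1..j}" "independent (x ` {1..j})"
    using orthonormal_independent[OF bi(2) _ on, of "{1..j}"] by auto
  have "\<exists>w\<in>span (x ` {1..j}). w \<noteq> 0 \<and>
      tlam h j * B (P h w) (P h w) \<le> A (P h w) (P h w)"
  proof (rule min_max_trial_vector[OF biA biB lin_P ind(2)])
    show "card (x ` {1..j}) = j" using ind(1) by (simp add: card_image)
    show "P h ` span (x ` {1..j}) \<subseteq> span (tu h ` {1..n})"
      using PV tu_basis(3)[OF h] by (auto simp: n_def)
  qed (use j jn tu[OF h] tlam(2)[OF h] in \<open>auto simp: A_def B_def n_def\<close>)
  then obtain w where w: "w \<in> U" "w \<noteq> 0"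
    and trial: "tlam h j * B (P h w) (P h w) \<le> A (P h w) (P h w)" by (auto simp: U_def)

  have "0 \<le> form_norm A (w - P h w)" "0 < form_norm A w"
    using form_norm_nonneg[OF A] form_norm_pos[where f = A] A_pos[OF w] by auto
  moreover have approx: "form_norm A (w - P h w) \<le> \<Theta> h j * form_norm A w"
    using approx_const_bound[OF A proj w A_pos[OF w]] by (simp add: \<Theta>(1) Uk A_def)
  ultimately have \<Theta>0: "0 \<le> \<Theta> h j"
    by (meson order_trans zero_le_mult_iff not_less)
  have \<Theta>_half: "\<Theta> h j \<le> 1/2" using \<Theta>(2)[OF h j] .
  have small: "\<alpha> h < 1/2" "\<beta> h < 1/2" "t\<alpha> h < 1/2" "t\<beta> h < 1/2" using less_half[OF h] by auto
  have cA: "\<bar>A v z - a' v z\<bar> \<le> t\<alpha> h * form_norm A v * form_norm A z"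
    and cB: "\<bar>B v z - b' v z\<bar> \<le> t\<beta> h * form_norm B v * form_norm B z"
    if "v \<in> U" "z \<in> Z" for v z
    using consistency2[OF h, of v z] that U_sub by (auto simp: A_def B_def a'_def b'_def Z_def)
  have nonneg: "0 \<le> \<alpha> h" "0 \<le> \<beta> h"
    using consA[OF w(1)] consB[OF w(1)] A_pos[OF w] B_pos[OF w]
    by (meson abs_ge_zero order_trans zero_le_mult_iff not_less)+
  have t_nonneg: "0 \<le> t\<alpha> h" "0 \<le> t\<beta> h"
    using consistency_constant_nonneg[OF cA A_pos[OF w]]
      consistency_constant_nonneg[OF cB B_pos[OF w]] w(1) U_Z by auto
  have F: "form_norm B z \<le> cF * form_norm A z" if "z \<in> Z" for z
    using friedrichs(2)[OF h] that by (simp add: A_def B_def Z_def)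

  \<comment> \<open>\<open>L\<close> collects the chain \<open>(1 - \<alpha>) A \<le> a' \<le>
    \<lambda>_j b' \<le> \<lambda>_j (1 + \<beta>) B\<close> on the diagonal over \<open>U\<close>;
    \<open>\<epsilon>\<close> is the constant of \<open>source_problem_defect\<close>.\<close>
  define L where "L = lam j * (1 + \<beta> h) / (1 - \<alpha> h)"
  define \<epsilon> where "\<epsilon> = 2 * cF * (t\<alpha> h + t\<beta> h)"
  have L_pos: "0 < L" using lam_j nonneg small by (simp add: L_def)
  have \<epsilon>: "0 \<le> \<epsilon>" using t_nonneg friedrichs(1) by (simp add: \<epsilon>_def)
  have L: "A z z \<le> L * B z z" if z: "z \<in> U" for z
  proof -
    have "(1 - \<alpha> h) * A z z \<le> a' z z" using consA[OF z] by (simp add: algebra_simps)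
    also have "\<dots> \<le> lam j * b' z z" using rayleigh[OF z] .
    also have "\<dots> \<le> lam j * ((1 + \<beta> h) * B z z)"
      using consB[OF z] lam_j by (intro mult_left_mono) (auto simp: algebra_simps)
    finally show ?thesis using small(1) by (simp add: L_def field_simps)
  qed
  have bound: "(1 - (\<Theta> h j)\<^sup>2) * (1 - 8 / 3 * sqrt L * \<epsilon> * \<Theta> h j) * A (P h w) (P h w)
      \<le> L * B (P h w) (P h w)"
  proof (rule projected_rayleigh_bound[OF A B _ _ _ V(1)[OF h] proj])
    show "w \<in> span (x ` {1..j})" using w(1) by (simp add: U_def)
    show "pos_def_on A (span (x ` {1..j}))" "pos_def_on B (span (x ` {1..j}))"
      using A_pos B_pos by (auto simp: pos_def_on_def U_def)
    fix y assume y: "y \<in> span (x ` {1..j})"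
    have "\<exists>r\<in>span (x ` {1..j}). \<forall>z\<in>Z. \<bar>B y z - A r z\<bar>
        \<le> 2 * cF * (t\<alpha> h + t\<beta> h) * form_norm B y * form_norm A z"
      by (rule source_problem_defect[OF A B bi _ on eig _ t_nonneg(1) small(3) t_nonneg(2)
            friedrichs(1) _ cA cB F y])
        (use U_Z lam_pos j in \<open>auto simp: U_def\<close>)
    then show "\<exists>r\<in>span (x ` {1..j}). \<forall>z\<in>sum_space (V h) (span (x ` {1..j})).
        \<bar>B y z - A r z\<bar> \<le> \<epsilon> * form_norm B y * form_norm A z"
      using sum_Z by (auto simp: \<epsilon>_def U_def)
  qed (use w L L_pos \<Theta>0 \<Theta>_half approx \<epsilon> in \<open>auto simp: U_def\<close>)

  \<comment> \<open>Assembling the constants\<close>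
  define c where "c = 1 - 2 * chat * (t\<alpha> h + t\<beta> h) * \<Theta> h j"
  have \<Theta>2: "(\<Theta> h j)\<^sup>2 \<le> 1/4"
    using power_mono[OF \<Theta>_half \<Theta>0, of 2] by (simp add: power2_eq_square)
  have tlam_pos: "0 < tlam h j" using tlam(1)[OF h, of j] j jn by (auto simp: n_def)
  have pre: "0 \<le> (1 - 2 * \<alpha> h) * (1 - 2 * \<beta> h) * (1 - (\<Theta> h j)\<^sup>2)"
    using small \<Theta>2 by (intro mult_nonneg_nonneg) auto
  have "(1 - 2 * \<alpha> h) * (1 - 2 * \<beta> h) * (1 - (\<Theta> h j)\<^sup>2) * c * tlam h j \<le> lam j"
  proof (cases "c \<le> 0")
    case True
    then have "(1 - 2 * \<alpha> h) * (1 - 2 * \<beta> h) * (1 - (\<Theta> h j)\<^sup>2) * c * tlam h j \<le> 0"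
      using pre tlam_pos by (intro mult_nonpos_nonneg mult_nonneg_nonpos) auto
    then show ?thesis using lam_j(1) by linarith
  next
    case False
    \<comment> \<open>Constants below 1/2 give (3/2) / (1/2) = 3. The resulting
      \<open>sqrt 3\<close> turns 8/3 into the \<open>8 / sqrt 3\<close> of \<open>chat\<close>, and
      the 2 in \<open>\<epsilon>\<close> is the 2 in front of \<open>chat\<close>.\<close>
    have "(1 + \<beta> h) / (1 - \<alpha> h) \<le> 3" using small nonneg by (simp add: field_simps)
    then have "L \<le> lam j * 3"
      using lam_j(1) mult_left_mono[of "(1 + \<beta> h) / (1 - \<alpha> h)" 3 "lam j"] by (simp add: L_def)
    then have "sqrt L \<le> sqrt (3 * lam kmax)" using lam_j by simp
    then have "sqrt L \<le> sqrt 3 * sqrt (lam kmax)" by (simp add: real_sqrt_mult)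
    then have "8 / 3 * sqrt L * \<epsilon> * \<Theta> h j \<le> 8 / 3 * (sqrt 3 * sqrt (lam kmax)) * \<epsilon> * \<Theta> h j"
      using \<epsilon> \<Theta>0 by (intro mult_right_mono mult_left_mono) auto
    also have "\<dots> = 2 * chat * (t\<alpha> h + t\<beta> h) * \<Theta> h j"
    proof -
      have "8 / sqrt (3::real) = 8 / 3 * sqrt 3" by (simp add: field_simps)
      then show ?thesis by (simp only: chat \<epsilon>_def mult_ac)
    qed
    finally have c_le: "c \<le> 1 - 8 / 3 * sqrt L * \<epsilon> * \<Theta> h j" by (simp add: c_def)
    define p where "p = A (P h w) (P h w)"
    define q where "q = B (P h w) (P h w)"
    \<comment> \<open>The min-max step leaves open whether \<open>P h w\<close> vanishes;
      \<open>\<Theta> \<le> 1/2\<close> and Pythagoras keep at least 3/4 of \<open>A w w\<close>, so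
      \<open>p\<close> can be cancelled below.\<close>
    have p: "0 < p"
    proof -
      have "(form_norm A (w - P h w))\<^sup>2 \<le> (\<Theta> h j * form_norm A w)\<^sup>2"
        using approx form_norm_nonneg[OF A] by (intro power_mono) auto
      also have "\<dots> \<le> 1/4 * A w w"
        using \<Theta>2 A_pos[OF w] by (simp add: power_mult_distrib form_norm_sq[OF A])
      finally show ?thesis
        using A_pos[OF w] orth_proj_pythagoras[OF A proj, of w]
        by (simp add: form_norm_sq[OF A] p_def)
    qed
    have "(1 - (\<Theta> h j)\<^sup>2) * c * p \<le> (1 - (\<Theta> h j)\<^sup>2) * (1 - 8 / 3 * sqrt L * \<epsilon> * \<Theta> h j) * p"
      using c_le \<Theta>2 p by (intro mult_right_mono mult_left_mono) auto
    also have "\<dots> \<le> L * q" using bound by (simp add: p_def q_def)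
    finally have "tlam h j * ((1 - (\<Theta> h j)\<^sup>2) * c * p) \<le> tlam h j * (L * q)"
      using tlam_pos by simp
    also have "\<dots> \<le> L * p"
      using trial L_pos mult_left_mono[of "tlam h j * q" p L] by (simp add: p_def q_def mult_ac)
    finally have "(1 - (\<Theta> h j)\<^sup>2) * c * tlam h j * p \<le> L * p" by (simp add: mult_ac)
    then have "(1 - (\<Theta> h j)\<^sup>2) * c * tlam h j \<le> L" using p by simp
    then have "(1 - 2 * \<alpha> h) * (1 - 2 * \<beta> h) * ((1 - (\<Theta> h j)\<^sup>2) * c * tlam h j)
        \<le> (1 - 2 * \<alpha> h) * (1 - 2 * \<beta> h) * L"
      using small by (intro mult_left_mono) auto
    also have "\<dots> \<le> lam j"
    proof -
      \<comment> \<open>The factors \<open>1 - 2\<beta>\<close> and \<open>1 - 2\<alpha>\<close>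
        absorb \<open>1 + \<beta>\<close> and \<open>1 / (1 - \<alpha>)\<close> in
        \<open>L\<close>.\<close>
      have "(1 - 2 * \<beta> h) * (1 + \<beta> h) \<le> 1"
        using nonneg(2) by (simp add: algebra_simps)
      then have "(1 - 2 * \<alpha> h) * ((1 - 2 * \<beta> h) * (1 + \<beta> h)) \<le> (1 - 2 * \<alpha> h) * 1"
        using small(1) by (intro mult_left_mono) auto
      then have "(1 - 2 * \<alpha> h) * ((1 - 2 * \<beta> h) * (1 + \<beta> h)) \<le> 1 - \<alpha> h"
        using nonneg(1) by simp
      then have "lam j * ((1 - 2 * \<alpha> h) * ((1 - 2 * \<beta> h) * (1 + \<beta> h))) \<le> lam j * (1 - \<alpha> h)"
        using lam_j(1) by simp
      then show ?thesis using small(1) by (simp add: L_def field_simps)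
    qed
    finally show ?thesis by (simp add: mult.assoc)
  qed
  then show "lam j \<ge> (1 - 2 * \<alpha> h) * (1 - 2 * \<beta> h) * (1 - (\<Theta> h j)\<^sup>2)
      * (1 - 2 * chat * (t\<alpha> h + t\<beta> h) * \<Theta> h j) * tlam h j"
    by (simp add: c_def)
qed

end
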